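(* Let $A=A^*$ be an $N\times N$ invertible matrix, let $m$ be a positive integer and let $\epsilon>0$. Consider the following two assertions: (I) $C_\epsilon(A)\ge m$; (II) there exists an index subset $\gamma_m=\{i_1,\ldots,i_{2m}\}$ of $\{1,\ldots,N\}$, with $|\gamma_m|=2m$, such that for any subset $\gamma\supset\gamma_m$ of $\{1,\ldots,N\}$ for which the matrix $A^{-1}[\gamma]$ is invertible, $$C_{\epsilon/K}\left(\left(A^{-1}[\gamma]\right)^{-1}\right)\ge m\quad\text{for some }K>0.$$ Then (I) implies (II) with $K=\dfrac{C_m}{N}$, where $C_m=\dfrac{1}{m!\,2^{m-1}}$. Conversely, (II) with $K=1$ implies (I).
   Context: For a Hermitian matrix $M$ and $\delta>0$, $C_\delta(M)$ denotes the number of eigenvalues of $M$, counted with multiplicity, in the open interval $(-\delta,\delta)$. (The symbol $C_m$ with integer index $m$ denotes the numerical constant given in the claim.) For an $N\times N$ matrix $M$ and $\gamma\subset\{1,\ldots,N\}$, $M[\gamma]$ is the principal submatrix of $M$ with rows and columns indexed by $\gamma$; $A^{-1}[\gamma]$ means $(A^{-1})[\gamma]$.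
   Formalization: The implication (I) ⇒ (II) is stated for 2m ≤ N only: for 2m > N no index subset with 2m elements exists, so (II) fails although (I) may hold (N = m = 1, A = [1/2], ε = 1). The converse is unrestricted. *)

theory Defs
  imports
    "Jordan_Normal_Form.Schur_Decomposition"
    "Jordan_Normal_Form.Gauss_Jordan_Elimination"
    "Jordan_Normal_Form.DL_Submatrix"
    Complex_Main
begin

(* Multiplicity is algebraic (order as a root of the characteristic polynomial), which for the
   Hermitian matrices considered here agrees with the geometric one; only real eigenvalues
   are counted, and Hermitian matrices have no others. *)
definition eig_count :: "real \<Rightarrow> complex mat \<Rightarrow> nat" where
  "eig_count \<delta> M =
     (\<Sum>x \<in> {x :: real. eigenvalue M (complex_of_real x) \<and> - \<delta> < x \<and> x < \<delta>}.
        order (complex_of_real x) (char_poly M))"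

(* Meaningful only when invertible_mat M holds; otherwise the value is unspecified. *)
definition inv_mat :: "complex mat \<Rightarrow> complex mat" where
  "inv_mat M = the (mat_inverse M)"

definition principal_submatrix :: "complex mat \<Rightarrow> nat set \<Rightarrow> complex mat" where
  "principal_submatrix M \<gamma> = submatrix M \<gamma> \<gamma>"

(* Rows and columns are numbered from 0, so {..<N} plays the role of {1,...,N}.
   The inclusion of \<gamma>m in \<gamma> is not strict. *)
definition submatrix_inverse_condition :: "nat \<Rightarrow> complex mat \<Rightarrow> nat \<Rightarrow> real \<Rightarrow> real \<Rightarrow> bool" where
  "submatrix_inverse_condition N A m \<epsilon> K \<longleftrightarrow>
     (\<exists>\<gamma>m \<subseteq> {..<N}. card \<gamma>m = 2 * m \<and>
        (\<forall>\<gamma>. \<gamma>m \<subseteq> \<gamma> \<and> \<gamma> \<subseteq> {..<N} \<and> invertible_mat (principal_submatrix (inv_mat A) \<gamma>) \<longrightarrow>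
             m \<le> eig_count (\<epsilon> / K) (inv_mat (principal_submatrix (inv_mat A) \<gamma>))))"

definition C_const :: "nat \<Rightarrow> real" where
  "C_const m = 1 / (fact m * 2 ^ (m - 1))"

end

(*
  Let B = inv A. Assertion (I) gives m orthonormal eigenvectors of B whose eigenvalues exceed
  1/epsilon in modulus. Let J index a maximal m x m minor of the N x m matrix U of these
  eigenvectors. By Cramer's rule every row of U is a combination of the rows in J with
  coefficients of modulus at most 1, so the rows in J lose at most a factor sqrt(m N) in the
  lower norm bound, and B, restricted to vectors supported on J, is bounded below by
  1/(c sqrt(m N)) for some c < epsilon. Selecting rows I of B[.,J] in the same way bounds
  B[I,J] below by 1/(m N c). This survives in every B[gamma] with I, J contained in gamma:
  were fewer than m eigenvalues of inv (B[gamma]) small, some nonzero vector supported on J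
  would be orthogonal to all the corresponding eigenvectors, contradicting the bound. The
  factor m N is at most N/C_m since m <= m! 2^(m-1). The converse is the case gamma = {..<N}.
*)

theory Submission
  imports Defs "Jordan_Normal_Form.Spectral_Radius" "HOL-Analysis.Convex"
begin

section \<open>Conjugate transposes\<close>

lemma mat_adjoint_carrier [simp]: "A \<in> carrier_mat n k \<Longrightarrow> mat_adjoint A \<in> carrier_mat k n"
  unfolding mat_adjoint_def by (auto simp: mat_of_rows_def)

lemma mat_adjoint_dim [simp]: "dim_row (mat_adjoint A) = dim_col A" "dim_col (mat_adjoint A) = dim_row A"
  unfolding mat_adjoint_def by (auto simp: mat_of_rows_def)

lemma mat_adjoint_index [simp]:
  assumes "i < dim_col A" "j < dim_row A"
  shows "mat_adjoint (A :: complex mat) $$ (i, j) = cnj (A $$ (j, i))"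
  using assms unfolding mat_adjoint_def by (auto simp: mat_of_rows_def)

lemma mat_adjoint_adjoint [simp]: "mat_adjoint (mat_adjoint (A :: complex mat)) = A"
  by (rule eq_matI) auto

lemma mat_adjoint_mult:
  assumes "A \<in> carrier_mat n k" "B \<in> carrier_mat k l"
  shows "mat_adjoint (A * B :: complex mat) = mat_adjoint B * mat_adjoint A"
  using assms by (intro eq_matI) (auto simp: scalar_prod_def mult.commute intro!: sum.cong)

lemma mat_adjoint_one [simp]: "mat_adjoint (1\<^sub>m n :: complex mat) = 1\<^sub>m n"
  by (rule eq_matI) auto

section \<open>Unitary diagonalization of Hermitian matrices\<close>

text \<open>Over the complex numbers \<open>M\<close> has an eigenvector. Completing it to a basis,
  applying Gram-Schmidt, which keeps the first vector, and normalizing gives the columns of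
  \<open>W\<close>.\<close>

lemma unitary_first_column_eigenvector:
  fixes M :: "complex mat"
  assumes M: "M \<in> carrier_mat n n" and n: "n > 0"
  obtains W e where "W \<in> carrier_mat n n" "mat_adjoint W * W = 1\<^sub>m n"
    "M *\<^sub>v col W 0 = e \<cdot>\<^sub>v col W 0"
proof -
  obtain e where e: "eigenvalue M e"
    using spectrum_non_empty[OF M] n unfolding spectrum_def by auto
  then obtain v where v: "v \<in> carrier_vec n" and v0: "v \<noteq> 0\<^sub>v n" and ev: "M *\<^sub>v v = e \<cdot>\<^sub>v v"
    using M unfolding eigenvalue_def eigenvector_def by auto
  define b where "b = basis_completion v"
  define ws where "ws = gram_schmidt n b"
  interpret cof_vec_space n "TYPE(complex)" .
  from basis_completion[OF v v0, folded b_def]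
  have dist_b: "distinct b" and indep: "\<not> lin_dep (set b)" and b: "set b \<subseteq> carrier_vec n"
    and hdb: "hd b = v" and len_b: "length b = n" by auto
  from hdb len_b n obtain vs where bv: "b = v # vs" by (cases b) auto
  from gram_schmidt_result[OF b dist_b indep refl, folded ws_def]
  have ws: "set ws \<subseteq> carrier_vec n" and orth: "corthogonal ws" and len: "length ws = n"
    by (auto simp: len_b)
  from gram_schmidt_hd[OF v, of vs, folded bv] have "hd ws = v" unfolding ws_def .
  then have ws0: "ws ! 0 = v" using len n by (cases ws) auto
  \<comment> \<open>\<open>corthogonal\<close> yields pairwise orthogonal nonzero vectors of
    arbitrary length; the squared norms \<open>s i\<close> serve to scale them.\<close>
  define s where "s i = (\<Sum>k<n. (cmod (ws ! i $ k))\<^sup>2)" for i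
  have wsc: "ws ! i \<in> carrier_vec n" if "i < n" for i using ws len that by auto
  have wdim: "dim_vec (ws ! i) = n" if "i < n" for i using wsc[OF that] by simp
  have cnj_sum: "(\<Sum>k<n. cnj (ws ! i $ k) * ws ! j $ k) = (ws ! j \<bullet>c ws ! i)" if "i < n" "j < n" for i j
    using wdim that by (auto simp: scalar_prod_def atLeast0LessThan mult.commute intro!: sum.cong)
  have self: "(\<Sum>k<n. cnj (ws ! i $ k) * ws ! i $ k) = of_real (s i)" for i
    unfolding s_def of_real_sum complex_norm_square by (intro sum.cong refl) (simp add: mult.commute)
  have spos: "s i > 0" if "i < n" for i
  proof -
    have "s i \<noteq> 0" using cnj_sum[OF that that] corthogonalD[OF orth, of i i] self[of i] that len by auto
    moreover have "s i \<ge> 0" unfolding s_def by (intro sum_nonneg) auto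
    ultimately show ?thesis by simp
  qed
  define W where "W = mat n n (\<lambda>(k, i). ws ! i $ k / of_real (sqrt (s i)))"
  have W: "W \<in> carrier_mat n n" unfolding W_def by simp
  have WW: "mat_adjoint W * W = 1\<^sub>m n"
  proof (rule eq_matI)
    fix i j assume "i < dim_row (1\<^sub>m n)" "j < dim_col (1\<^sub>m n)"
    then have i: "i < n" and j: "j < n" by auto
    have "(mat_adjoint W * W) $$ (i, j) =
        (\<Sum>k<n. cnj (ws ! i $ k) * ws ! j $ k) / (of_real (sqrt (s i)) * of_real (sqrt (s j)))"
      using i j W unfolding sum_divide_distrib
      by (auto simp: scalar_prod_def W_def atLeast0LessThan intro!: sum.cong)
    also have "\<dots> = (if i = j then 1 else 0)"
    proof (cases "i = j")
      case True
      have "of_real (sqrt (s j)) * of_real (sqrt (s j)) = (of_real (s j) :: complex)"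
        using spos[OF j] by (simp flip: of_real_mult)
      then show ?thesis unfolding True using spos[OF j] by (simp add: self)
    next
      case False
      then show ?thesis using cnj_sum[OF i j] corthogonalD[OF orth, of j i] len i j by simp
    qed
    finally show "(mat_adjoint W * W) $$ (i, j) = 1\<^sub>m n $$ (i, j)" using i j by simp
  qed (use W in auto)
  have col0: "col W 0 = (1 / of_real (sqrt (s 0))) \<cdot>\<^sub>v v"
    using n v by (intro eq_vecI) (auto simp: W_def ws0)
  have "M *\<^sub>v col W 0 = e \<cdot>\<^sub>v col W 0"
    unfolding col0 using M v by (simp add: mult_mat_vec ev smult_smult_assoc mult.commute)
  from that[OF W WW this] show ?thesis .
qed

text \<open>Deflation by induction on \<open>n\<close>: in a unitary basis that starts with an
  eigenvector, the first column of \<open>M\<close> vanishes below its top entry, Hermitian symmetry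
  clears the first row as well, and the remaining block is again Hermitian. That \<open>D\<close> is
  real is derived in \<open>hermitian_spectral\<close>.\<close>

lemma hermitian_unitary_diagonalization:
  fixes M :: "complex mat"
  assumes "M \<in> carrier_mat n n" "mat_adjoint M = M"
  shows "\<exists>W D. W \<in> carrier_mat n n \<and> mat_adjoint W * W = 1\<^sub>m n \<and> D \<in> carrier_mat n n \<and>
    diagonal_mat D \<and> M = W * D * mat_adjoint W"
  using assms
proof (induction n arbitrary: M)
  case 0
  then show ?case by (intro exI[of _ M]) (auto simp: diagonal_mat_def)
next
  case (Suc n)
  note M = Suc.prems(1) and herm = Suc.prems(2)
  obtain V e where V: "V \<in> carrier_mat (Suc n) (Suc n)" and VV: "mat_adjoint V * V = 1\<^sub>m (Suc n)"
    and ev: "M *\<^sub>v col V 0 = e \<cdot>\<^sub>v col V 0"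
    using unitary_first_column_eigenvector[OF M] by blast
  have V': "mat_adjoint V \<in> carrier_mat (Suc n) (Suc n)" using V by simp
  have VV': "V * mat_adjoint V = 1\<^sub>m (Suc n)"
    using mat_mult_left_right_inverse[OF V' V VV] .
  define A' where "A' = mat_adjoint V * M * V"
  have A': "A' \<in> carrier_mat (Suc n) (Suc n)" unfolding A'_def using V V' M by auto
  have A'herm: "mat_adjoint A' = A'"
  proof -
    have "mat_adjoint A' = mat_adjoint V * (mat_adjoint M * V)"
      unfolding A'_def using mat_adjoint_mult[OF mult_carrier_mat[OF V' M] V]
        mat_adjoint_mult[OF V' M] by simp
    then show ?thesis unfolding A'_def herm using assoc_mult_mat[OF V' M V] by simp
  qed
  have col0: "A' $$ (i, 0) = (if i = 0 then e else 0)" if i: "i < Suc n" for i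
  proof -
    have c: "col V 0 \<in> carrier_vec (Suc n)" using col_dim[of V 0] V by simp
    have "A' $$ (i, 0) = col A' 0 $ i" using A' i by simp
    also have "col A' 0 = mat_adjoint V * M *\<^sub>v col V 0"
      unfolding A'_def by (rule col_mult2[OF mult_carrier_mat[OF V' M] V]) simp
    also have "\<dots> = mat_adjoint V *\<^sub>v (e \<cdot>\<^sub>v col V 0)"
      using assoc_mult_mat_vec[OF V' M c] ev by simp
    also have "\<dots> = e \<cdot>\<^sub>v (mat_adjoint V *\<^sub>v col V 0)" using mult_mat_vec[OF V' c] .
    also have "mat_adjoint V *\<^sub>v col V 0 = col (mat_adjoint V * V) 0"
      by (rule col_mult2[OF V' V, symmetric]) simp
    finally show ?thesis using i unfolding VV by simp
  qed
  have row0: "A' $$ (0, i) = (if i = 0 then e else 0)" if i: "i < Suc n" for i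
  proof (cases "i = 0")
    case False
    have "A' $$ (0, i) = mat_adjoint A' $$ (0, i)" by (simp add: A'herm)
    also have "\<dots> = cnj (A' $$ (i, 0))" using A' i by auto
    finally show ?thesis using col0[OF i] False by simp
  qed (use col0 in auto)
  define A3 where "A3 = mat n n (\<lambda>(i, j). A' $$ (Suc i, Suc j))"
  have A3: "A3 \<in> carrier_mat n n" unfolding A3_def by simp
  have "mat_adjoint A3 = A3"
  proof (rule eq_matI)
    fix i j assume "i < dim_row A3" "j < dim_col A3"
    then have i: "i < n" and j: "j < n" using A3 by auto
    have "A' $$ (Suc i, Suc j) = mat_adjoint A' $$ (Suc i, Suc j)" by (simp add: A'herm)
    also have "\<dots> = cnj (A' $$ (Suc j, Suc i))" using A' i j by auto
    finally show "mat_adjoint A3 $$ (i, j) = A3 $$ (i, j)" using i j by (simp add: A3_def)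
  qed (use A3 in auto)
  from Suc.IH[OF A3 this] obtain U D where U: "U \<in> carrier_mat n n" and UU: "mat_adjoint U * U = 1\<^sub>m n"
    and D: "D \<in> carrier_mat n n" and diag: "diagonal_mat D" and A3eq: "A3 = U * D * mat_adjoint U" by blast
  \<comment> \<open>The unitary \<open>U\<close> of the smaller block is extended by a leading 1 to
    \<open>Y\<close>; the unitary that diagonalizes \<open>M\<close> will be
    \<open>V * Y\<close>.\<close>
  define E where "E = mat 1 1 (\<lambda>_. e)"
  define Y where "Y = four_block_mat (1\<^sub>m 1) (0\<^sub>m 1 n) (0\<^sub>m n 1) U"
  define Y' where "Y' = four_block_mat (1\<^sub>m 1) (0\<^sub>m 1 n) (0\<^sub>m n 1) (mat_adjoint U)"
  define C where "C = four_block_mat E (0\<^sub>m 1 n) (0\<^sub>m n 1) D"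
  have E: "E \<in> carrier_mat 1 1" unfolding E_def by simp
  have Y: "Y \<in> carrier_mat (Suc n) (Suc n)" and C: "C \<in> carrier_mat (Suc n) (Suc n)"
    and Y'c: "Y' \<in> carrier_mat (Suc n) (Suc n)"
    unfolding Y_def C_def Y'_def
    using four_block_carrier_mat[OF one_carrier_mat[of 1] U] four_block_carrier_mat[OF E D]
      four_block_carrier_mat[OF one_carrier_mat[of 1] mat_adjoint_carrier[OF U]] by simp_all
  have adjY: "mat_adjoint Y = Y'"
    using U unfolding Y_def Y'_def by (intro eq_matI) auto
  have U': "mat_adjoint U \<in> carrier_mat n n" using U by simp
  have block: "four_block_mat P (0\<^sub>m 1 n) (0\<^sub>m n 1) Q * four_block_mat R (0\<^sub>m 1 n) (0\<^sub>m n 1) S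
      = four_block_mat (P * R) (0\<^sub>m 1 n) (0\<^sub>m n 1) (Q * S)"
    if "P \<in> carrier_mat 1 1" "R \<in> carrier_mat 1 1" "Q \<in> carrier_mat n n" "S \<in> carrier_mat n n"
    for P Q R S :: "complex mat"
    using mult_four_block_mat[OF that(1) zero_carrier_mat zero_carrier_mat that(3)
        that(2) zero_carrier_mat zero_carrier_mat that(4)] that by auto
  have YY: "mat_adjoint Y * Y = 1\<^sub>m (Suc n)"
    unfolding adjY unfolding Y_def Y'_def using block[OF one_carrier_mat one_carrier_mat U' U]
    by (auto simp: UU)
  have "A' = four_block_mat E (0\<^sub>m 1 n) (0\<^sub>m n 1) A3"
  proof (rule eq_matI)
    fix i j assume "i < dim_row (four_block_mat E (0\<^sub>m 1 n) (0\<^sub>m n 1) A3)"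
      "j < dim_col (four_block_mat E (0\<^sub>m 1 n) (0\<^sub>m n 1) A3)"
    then have "i < Suc n" "j < Suc n" using E A3 by auto
    then show "A' $$ (i, j) = four_block_mat E (0\<^sub>m 1 n) (0\<^sub>m n 1) A3 $$ (i, j)"
      using col0[of i] row0[of j] by (cases i; cases j) (auto simp: E_def A3_def)
  qed (use A' E A3 in auto)
  also have "\<dots> = Y * C * Y'"
    unfolding Y_def C_def Y'_def A3eq block[OF one_carrier_mat E U D]
      left_mult_one_mat[OF E] block[OF E one_carrier_mat mult_carrier_mat[OF U D] U']
      right_mult_one_mat[OF E] ..
  finally have A'eq: "A' = Y * C * mat_adjoint Y" using adjY by simp
  have "V * A' * mat_adjoint V = (V * mat_adjoint V) * M * (V * mat_adjoint V)"
    unfolding A'_def using V V' M by (simp add: assoc_mult_mat[of _ "Suc n" "Suc n" _ "Suc n" _ "Suc n"] 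
        mult_carrier_mat[of _ "Suc n" "Suc n"])
  then have "M = V * A' * mat_adjoint V" unfolding VV' using M by simp
  also have "\<dots> = (V * Y) * C * mat_adjoint (V * Y)"
    unfolding A'eq mat_adjoint_mult[OF V Y] adjY using V V' Y Y'c C 
    by (simp add: assoc_mult_mat[of _ "Suc n" "Suc n" _ "Suc n" _ "Suc n"] mult_carrier_mat[of _ "Suc n" "Suc n"])
  finally have Meq: "M = (V * Y) * C * mat_adjoint (V * Y)" .
  have "mat_adjoint (V * Y) * (V * Y) = mat_adjoint Y * (mat_adjoint V * V) * Y"
    unfolding mat_adjoint_mult[OF V Y] adjY using V V' Y Y'c
    by (simp add: assoc_mult_mat[of _ "Suc n" "Suc n" _ "Suc n" _ "Suc n"] mult_carrier_mat[of _ "Suc n" "Suc n"])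
  also have "\<dots> = 1\<^sub>m (Suc n)" unfolding VV adjY using Y Y'c YY adjY by simp
  finally have un: "mat_adjoint (V * Y) * (V * Y) = 1\<^sub>m (Suc n)" .
  have "diagonal_mat C" using diag D E unfolding C_def diagonal_mat_def by auto
  then show ?case using Meq un C mult_carrier_mat[OF V Y] by blast
qed

text \<open>Expanding the squares gives the quadratic form of the Gram matrix
  \<open>mat_adjoint X * X\<close>. The conclusion is phrased in entrywise sums, the form in which
  the later estimates are written.\<close>

lemma unitary_norm_preserving:
  fixes X :: "complex mat" and y :: "nat \<Rightarrow> complex"
  assumes X: "X \<in> carrier_mat n k" and XX: "mat_adjoint X * X = 1\<^sub>m k"
  shows "(\<Sum>i<n. (cmod (\<Sum>j<k. X $$ (i, j) * y j))\<^sup>2) = (\<Sum>j<k. (cmod (y j))\<^sup>2)"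
proof -
  have gram: "(\<Sum>i<n. cnj (X $$ (i, l)) * X $$ (i, j)) = (if l = j then 1 else 0)"
    if "l < k" "j < k" for l j
  proof -
    have "(mat_adjoint X * X) $$ (l, j) = (\<Sum>i<n. cnj (X $$ (i, l)) * X $$ (i, j))"
      using X that by (auto simp: scalar_prod_def atLeast0LessThan intro!: sum.cong)
    then show ?thesis using XX that by simp
  qed
  have "complex_of_real (\<Sum>i<n. (cmod (\<Sum>j<k. X $$ (i, j) * y j))\<^sup>2) =
      (\<Sum>i<n. \<Sum>j<k. \<Sum>l<k. X $$ (i, j) * y j * (cnj (X $$ (i, l)) * cnj (y l)))"
    unfolding of_real_sum complex_norm_square by (simp add: sum_product)
  also have "\<dots> = (\<Sum>j<k. \<Sum>l<k. \<Sum>i<n. X $$ (i, j) * y j * (cnj (X $$ (i, l)) * cnj (y l)))"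
    by (subst sum.swap) (intro sum.cong refl sum.swap)
  also have "\<dots> = (\<Sum>j<k. \<Sum>l<k. y j * cnj (y l) * (\<Sum>i<n. cnj (X $$ (i, l)) * X $$ (i, j)))"
    unfolding sum_distrib_left by (intro sum.cong refl) (simp add: mult_ac)
  also have "\<dots> = (\<Sum>j<k. \<Sum>l<k. if l = j then y j * cnj (y l) else 0)"
    by (intro sum.cong refl) (simp add: gram)
  also have "\<dots> = (\<Sum>j<k. y j * cnj (y j))"
    by (intro sum.cong refl) simp
  also have "\<dots> = complex_of_real (\<Sum>j<k. (cmod (y j))\<^sup>2)"
    unfolding of_real_sum complex_norm_square ..
  finally show ?thesis using of_real_eq_iff by blast
qed

section \<open>Counting eigenvalues in a symmetric interval\<close>

text \<open>Similarity preserves the characteristic polynomial, which for \<open>D\<close> splits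
  into linear factors with roots \<open>d i\<close>; hence its order at \<open>x\<close> is the
  number of indices with \<open>d i = x\<close>. Grouping indices by the value of \<open>d\<close>
  turns the sum of orders into a cardinality.\<close>

lemma eig_count_diagonal:
  fixes M :: "complex mat" and d :: "nat \<Rightarrow> real"
  assumes M: "M \<in> carrier_mat n n" and D: "D \<in> carrier_mat n n" and sim: "similar_mat M D"
    and diag: "diagonal_mat D" and d: "\<And>i. i < n \<Longrightarrow> D $$ (i, i) = of_real (d i)"
  shows "eig_count \<delta> M = card {i. i < n \<and> \<bar>d i\<bar> < \<delta>}"
proof -
  have ut: "upper_triangular D" using diag D unfolding diagonal_mat_def by auto
  have cp: "char_poly M = (\<Prod>p\<leftarrow>map (\<lambda>i. [:- of_real (d i), 1:]) [0..<n]. p)"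
    unfolding char_poly_similar[OF sim] char_poly_upper_triangular[OF D ut] diag_mat_def
    using D d by (auto intro!: arg_cong[where f = prod_list])
  have ord: "order (of_real x) (char_poly M) = card {i. i < n \<and> d i = x}" for x
  proof -
    have "order (of_real x) (char_poly M) = (\<Sum>i\<leftarrow>[0..<n]. if d i = x then 1 else 0)"
      unfolding cp by (subst order_prod_list) (auto simp: o_def order_linear' intro!: arg_cong[where f = sum_list])
    also have "\<dots> = (\<Sum>i<n. if d i = x then 1 else 0)"
      by (simp add: interv_sum_list_conv_sum_set_nat atLeast0LessThan)
    also have "\<dots> = card ({..<n} \<inter> {i. d i = x})" by (simp add: sum.If_cases)
    finally show ?thesis by (simp add: Int_def)
  qed
  have ne: "char_poly M \<noteq> 0" using degree_monic_char_poly[OF M] by auto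
  have ev: "eigenvalue M (of_real x) \<longleftrightarrow> (\<exists>i<n. d i = x)" for x
  proof -
    have "eigenvalue M (of_real x) \<longleftrightarrow> order (of_real x) (char_poly M) \<noteq> 0"
      using eigenvalue_root_char_poly[OF M] order_root[of "char_poly M"] ne by auto
    then show ?thesis unfolding ord by (auto simp: card_eq_0_iff)
  qed
  define S where "S = {i. i < n \<and> \<bar>d i\<bar> < \<delta>}"
  have S: "finite S" unfolding S_def by simp
  have "{x. eigenvalue M (of_real x) \<and> - \<delta> < x \<and> x < \<delta>} = d ` S"
    unfolding ev S_def by (auto simp: abs_less_iff)
  then have "eig_count \<delta> M = (\<Sum>x\<in>d ` S. card {i. i < n \<and> d i = x})"
    unfolding eig_count_def ord by simp
  also have "\<dots> = (\<Sum>x\<in>d ` S. \<Sum>i\<in>{i. i \<in> S \<and> d i = x}. 1 :: nat)"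
    by (intro sum.cong refl) (auto simp: S_def intro!: arg_cong[where f = card])
  also have "\<dots> = (\<Sum>i\<in>S. 1)" by (rule sum.image_gen[OF S, symmetric])
  also have "\<dots> = card S" by simp
  finally show ?thesis unfolding S_def .
qed

text \<open>The rows of \<open>w\<close> are the conjugated eigenvectors, so that \<open>w\<close> is unitary and
  \<open>w M = diag(d) w\<close>.\<close>

lemma hermitian_spectral:
  fixes M :: "complex mat"
  assumes M: "M \<in> carrier_mat n n" and herm: "mat_adjoint M = M"
  shows "\<exists>(w :: nat \<Rightarrow> nat \<Rightarrow> complex) (d :: nat \<Rightarrow> real).
    (\<forall>y. (\<Sum>i<n. (cmod (\<Sum>j<n. w i j * y j))\<^sup>2) = (\<Sum>j<n. (cmod (y j))\<^sup>2)) \<and>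
    (\<forall>y. (\<Sum>j<n. (cmod (\<Sum>i<n. cnj (w i j) * y i))\<^sup>2) = (\<Sum>i<n. (cmod (y i))\<^sup>2)) \<and>
    (\<forall>i<n. \<forall>k<n. (\<Sum>j<n. w i j * M $$ (j, k)) = of_real (d i) * w i k) \<and>
    (\<forall>\<delta>. eig_count \<delta> M = card {i. i < n \<and> \<bar>d i\<bar> < \<delta>})"
proof -
  obtain W D where W: "W \<in> carrier_mat n n" and WW: "mat_adjoint W * W = 1\<^sub>m n"
    and D: "D \<in> carrier_mat n n" and diag: "diagonal_mat D" and Meq: "M = W * D * mat_adjoint W"
    using hermitian_unitary_diagonalization[OF M herm] by blast
  have W': "mat_adjoint W \<in> carrier_mat n n" using W by simp
  have WW': "W * mat_adjoint W = 1\<^sub>m n" using mat_mult_left_right_inverse[OF W' W WW] .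
  note assoc = assoc_mult_mat[of _ n n _ n _ n] mult_carrier_mat[of _ n n]
  have "mat_adjoint W * M = (mat_adjoint W * W) * (D * mat_adjoint W)"
    unfolding Meq using W W' D by (simp add: assoc)
  then have WM: "mat_adjoint W * M = D * mat_adjoint W" unfolding WW using D W' by simp
  have "D = D * (mat_adjoint W * W)" unfolding WW using D by simp
  also have "\<dots> = mat_adjoint W * M * W" unfolding WM using D W W' by (simp add: assoc)
  finally have Deq: "D = mat_adjoint W * M * W" .
  \<comment> \<open>\<open>D\<close> is a unitary conjugate of a Hermitian matrix, hence Hermitian,
    and so its diagonal entries are real.\<close>
  have Dherm: "mat_adjoint D = D"
    unfolding Deq using mat_adjoint_mult[OF mult_carrier_mat[OF W' M] W]
      mat_adjoint_mult[OF W' M] herm W W' M by (simp add: assoc)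
  define d where "d i = Re (D $$ (i, i))" for i
  have d: "D $$ (i, i) = of_real (d i)" if "i < n" for i
  proof -
    have "cnj (D $$ (i, i)) = D $$ (i, i)"
      using arg_cong[OF Dherm, of "\<lambda>X. X $$ (i, i)"] D that by simp
    then have "Im (D $$ (i, i)) = 0" by (metis cnj.simps(2) neg_equal_zero)
    then show ?thesis unfolding d_def by (simp add: complex_eq_iff)
  qed
  define w where "w i j = cnj (W $$ (j, i))" for i j
  have wi: "w i j = mat_adjoint W $$ (i, j)" if "i < n" "j < n" for i j
    using W that unfolding w_def by simp
  show ?thesis
  proof (intro exI[of _ w] exI[of _ d] conjI allI impI)
    fix y :: "nat \<Rightarrow> complex"
    show "(\<Sum>i<n. (cmod (\<Sum>j<n. w i j * y j))\<^sup>2) = (\<Sum>j<n. (cmod (y j))\<^sup>2)"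
      using unitary_norm_preserving[OF W', of y] WW' by (simp add: wi)
    show "(\<Sum>j<n. (cmod (\<Sum>i<n. cnj (w i j) * y i))\<^sup>2) = (\<Sum>i<n. (cmod (y i))\<^sup>2)"
      using unitary_norm_preserving[OF W WW, of y] by (simp add: w_def)
  next
    fix i k assume i: "i < n" and k: "k < n"
    have "(\<Sum>j<n. w i j * M $$ (j, k)) = (mat_adjoint W * M) $$ (i, k)"
      using W M i k by (auto simp: scalar_prod_def atLeast0LessThan w_def intro!: sum.cong)
    also have "\<dots> = (\<Sum>j<n. D $$ (i, j) * w j k)"
      unfolding WM using W D i k by (auto simp: scalar_prod_def atLeast0LessThan w_def intro!: sum.cong)
    also have "\<dots> = (\<Sum>j<n. if j = i then D $$ (i, i) * w i k else 0)"
      using diag D i unfolding diagonal_mat_def by (intro sum.cong refl) auto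
    finally show "(\<Sum>j<n. w i j * M $$ (j, k)) = of_real (d i) * w i k" using i by (simp add: d)
  next
    have "similar_mat_wit M D W (mat_adjoint W)"
      by (rule similar_mat_witI[OF WW' WW Meq M D W W'])
    then show "eig_count \<delta> M = card {i. i < n \<and> \<bar>d i\<bar> < \<delta>}" for \<delta>
      using eig_count_diagonal[OF M D _ diag d] unfolding similar_mat_def by blast
  qed
qed

section \<open>Row selection by maximal minors\<close>

lemma norm_sum_squared_le:
  fixes u :: "nat \<Rightarrow> complex"
  shows "(cmod (\<Sum>a<m. u a))\<^sup>2 \<le> real m * (\<Sum>a<m. (cmod (u a))\<^sup>2)"
proof -
  have "(cmod (\<Sum>a<m. u a))\<^sup>2 \<le> (\<Sum>a<m. cmod (u a))\<^sup>2"
    by (intro power_mono norm_sum) simp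
  also have "\<dots> \<le> (\<Sum>a<m. (cmod (u a))\<^sup>2) * card {..<m}"
    by (rule sum_squared_le_sum_of_squares)
  finally show ?thesis by (simp add: mult.commute)
qed

text \<open>Multilinear expansion of the Gram determinant, as in the Cauchy-Binet formula.\<close>

lemma exists_nonzero_minor:
  fixes w :: "nat \<Rightarrow> nat \<Rightarrow> complex"
  assumes inj: "\<And>y. (\<Sum>b<m. (cmod (y b))\<^sup>2) \<le> c * (\<Sum>i<N. (cmod (\<Sum>b<m. w i b * y b))\<^sup>2)"
  obtains f where "\<And>a. a < m \<Longrightarrow> f a < N" "det (mat m m (\<lambda>(a, b). w (f a) b)) \<noteq> 0"
proof -
  define W where "W = mat N m (\<lambda>(i, b). w i b)"
  define V where "V = mat m N (\<lambda>(b, i). cnj (w i b))"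
  have W: "W \<in> carrier_mat N m" and V: "V \<in> carrier_mat m N" unfolding W_def V_def by auto
  have VW: "V * W \<in> carrier_mat m m" using W V by simp
  \<comment> \<open>\<open>V\<close> is the adjoint of \<open>W\<close>, so \<open>V * W\<close> is
    the Gram matrix of the columns. A kernel vector \<open>v\<close> satisfies |W v|^2 = <V W v, v>
    = 0, and \<open>inj\<close> then forces \<open>v\<close> to vanish.\<close>
  have "det (V * W) \<noteq> 0"
  proof
    assume "det (V * W) = 0"
    then obtain v where v: "v \<in> carrier_vec m" "v \<noteq> 0\<^sub>v m" "V * W *\<^sub>v v = 0\<^sub>v m"
      using det_0_iff_vec_prod_zero[OF VW] by auto
    define u where "u i = (\<Sum>b<m. w i b * v $ b)" for i
    have u: "(W *\<^sub>v v) $ i = u i" if "i < N" for i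
      using that v W unfolding u_def W_def by (auto simp: scalar_prod_def atLeast0LessThan)
    have Vu: "(\<Sum>i<N. cnj (w i b) * u i) = 0" if "b < m" for b
    proof -
      have "0 = (V *\<^sub>v (W *\<^sub>v v)) $ b" using v(3) that assoc_mult_mat_vec[OF V W v(1)] by simp
      also have "\<dots> = (\<Sum>i<N. cnj (w i b) * u i)"
        using that V W u by (auto simp: scalar_prod_def atLeast0LessThan V_def intro!: sum.cong)
      finally show ?thesis by simp
    qed
    have "complex_of_real (\<Sum>i<N. (cmod (u i))\<^sup>2) = (\<Sum>i<N. \<Sum>b<m. u i * (cnj (w i b) * cnj (v $ b)))"
      unfolding of_real_sum complex_norm_square
      by (simp add: u_def[of _, THEN arg_cong[where f = cnj]] sum_distrib_left)
    also have "\<dots> = (\<Sum>b<m. \<Sum>i<N. u i * (cnj (w i b) * cnj (v $ b)))"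
      by (rule sum.swap)
    also have "\<dots> = (\<Sum>b<m. cnj (v $ b) * (\<Sum>i<N. cnj (w i b) * u i))"
      unfolding sum_distrib_left by (intro sum.cong refl) (simp add: mult_ac)
    also have "\<dots> = 0" by (simp add: Vu)
    finally have "(\<Sum>i<N. (cmod (u i))\<^sup>2) = 0" using of_real_eq_0_iff by blast
    then have "(\<Sum>b<m. (cmod (v $ b))\<^sup>2) \<le> 0" using inj[of "\<lambda>b. v $ b"] unfolding u_def by simp
    then have "(\<Sum>b<m. (cmod (v $ b))\<^sup>2) = 0" by (intro antisym sum_nonneg) auto
    then have "\<forall>b<m. v $ b = 0" by (subst (asm) sum_nonneg_eq_0_iff) auto
    then show False using v(1,2) by auto
  qed
  then have "det (mat\<^sub>r m m (\<lambda>b. finsum_vec TYPE(complex) m (\<lambda>i. V $$ (b, i) \<cdot>\<^sub>v row W i) {0..<N})) \<noteq> 0"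
    using mat_mul_finsum_alt[OF V W] by simp
  \<comment> \<open>Each row of \<open>V * W\<close> is a combination of rows of \<open>W\<close>,
    so multilinearity writes the determinant as a sum over all row choices \<open>f\<close>, whose
    values outside \<open>{0..<m}\<close> are fixed to keep the set finite.\<close>
  then have "(\<Sum>f\<in>{f. (\<forall>b\<in>{0..<m}. f b \<in> {0..<N}) \<and> (\<forall>b. b \<notin> {0..<m} \<longrightarrow> f b = b)}.
      det (mat\<^sub>r m m (\<lambda>b. V $$ (b, f b) \<cdot>\<^sub>v row W (f b)))) \<noteq> 0"
    using W by (subst (asm) det_linear_rows_sum) (auto simp: Pi_def)
  then obtain f where f: "\<forall>b\<in>{0..<m}. f b \<in> {0..<N}"
    and nz: "det (mat\<^sub>r m m (\<lambda>b. V $$ (b, f b) \<cdot>\<^sub>v row W (f b))) \<noteq> 0"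
    by (auto elim!: sum.not_neutral_contains_not_neutral)
  \<comment> \<open>The scalars \<open>V $$ (b, f b)\<close> factor out of the determinant, so the
    remaining minor of \<open>W\<close> cannot vanish.\<close>
  have "det (mat\<^sub>r m m (\<lambda>b. row W (f b))) \<noteq> 0"
    using nz W f by (subst (asm) det_rows_mul) (auto simp: Pi_def)
  also have "mat\<^sub>r m m (\<lambda>b. row W (f b)) = mat m m (\<lambda>(a, b). w (f a) b)"
    using f W by (intro eq_matI) (auto simp: W_def)
  finally show ?thesis using that[of f] f by simp
qed

text \<open>Take a choice of \<open>m\<close> rows whose minor has the largest modulus. By Cramer's
  rule every row is a combination of the chosen ones with quotients of minors as coefficients, hence
  of modulus at most 1. Cauchy-Schwarz then costs a factor \<open>m\<close> for each row, and
  summing over all rows a factor \<open>N\<close>.\<close>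

lemma well_conditioned_row_selection:
  fixes w :: "nat \<Rightarrow> nat \<Rightarrow> complex"
  assumes inj: "\<And>y. (\<Sum>b<m. (cmod (y b))\<^sup>2) \<le> c * (\<Sum>i<N. (cmod (\<Sum>b<m. w i b * y b))\<^sup>2)"
    and c: "c \<ge> 0"
  obtains f where "inj_on f {..<m}" "f ` {..<m} \<subseteq> {..<N}"
    "\<And>y. (\<Sum>b<m. (cmod (y b))\<^sup>2) \<le> c * real m * real N * (\<Sum>a<m. (cmod (\<Sum>b<m. w (f a) b * y b))\<^sup>2)"
proof -
  define minor where "minor f = cmod (det (mat m m (\<lambda>(a, b). w (f a) b)))" for f
  obtain f0 where f0: "\<And>a. a < m \<Longrightarrow> f0 a < N" "minor f0 \<noteq> 0"
    using exists_nonzero_minor[OF inj] unfolding minor_def by auto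
  \<comment> \<open>\<open>PiE\<close> fixes the functions outside \<open>{..<m}\<close>, so there
    are finitely many and a maximum exists; \<open>minor_cong\<close> carries maximality over to
    functions that are arbitrary there.\<close>
  define F where "F = PiE {..<m} (\<lambda>_. {..<N})"
  have finF: "finite F" unfolding F_def by (intro finite_PiE) auto
  have minor_cong: "minor g = minor h" if "\<And>a. a < m \<Longrightarrow> g a = h a" for g h
    unfolding minor_def using that by (intro arg_cong[where f = "\<lambda>X. cmod (det X)"] eq_matI) auto
  have f0F: "restrict f0 {..<m} \<in> F" unfolding F_def using f0 by auto
  have "Max (minor ` F) \<in> minor ` F" using finF f0F by (intro Max_in) auto
  then obtain f where fF: "f \<in> F" and "minor f = Max (minor ` F)" by auto
  then have fmax: "minor g \<le> minor f" if "g \<in> F" for g using finF that by simp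
  have fN: "f a < N" if "a < m" for a using fF that unfolding F_def by auto
  have maxi: "minor g \<le> minor f" if "\<And>a. a < m \<Longrightarrow> g a < N" for g
  proof -
    have "restrict g {..<m} \<in> F" unfolding F_def using that by auto
    from fmax[OF this] show ?thesis using minor_cong[of "restrict g {..<m}" g] by simp
  qed
  have pos: "minor f > 0" using maxi[of f0] f0 zero_less_norm_iff unfolding minor_def by force
  \<comment> \<open>The selected rows become the columns of \<open>T\<close>, because
    \<open>cramer_lemma_mat\<close> replaces columns.\<close>
  define T where "T = mat m m (\<lambda>(b, a). w (f a) b)"
  have T: "T \<in> carrier_mat m m" unfolding T_def by simp
  have detT: "cmod (det (mat m m (\<lambda>(b, a). w (g a) b))) = minor g" for g
  proof -
    have "mat m m (\<lambda>(b, a). w (g a) b) = transpose_mat (mat m m (\<lambda>(a, b). w (g a) b))"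
      by (intro eq_matI) auto
    then show ?thesis unfolding minor_def by (simp add: det_transpose[of _ m])
  qed
  have injf: "inj_on f {..<m}"
  proof (rule inj_onI, rule ccontr)
    fix a a' assume "a \<in> {..<m}" "a' \<in> {..<m}" "f a = f a'" "a \<noteq> a'"
    then have "det (mat m m (\<lambda>(a, b). w (f a) b)) = 0"
      by (intro det_identical_rows[of _ m a a']) auto
    then show False using pos unfolding minor_def by simp
  qed
  have detT0: "det T \<noteq> 0" using detT[of f] pos unfolding T_def by auto
  have comb: "\<exists>x. (\<forall>a<m. cmod (x a) \<le> 1) \<and> (\<forall>b<m. w i b = (\<Sum>a<m. x a * w (f a) b))" if i: "i < N" for i
  proof -
    obtain T' where T': "T' \<in> carrier_mat m m" "T * T' = 1\<^sub>m m"
      using det_non_zero_imp_unit[OF T detT0, where b = "()"] unfolding Units_def ring_mat_def by auto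
    define r where "r = vec m (w i)"
    define x where "x = T' *\<^sub>v r"
    have r: "r \<in> carrier_vec m" unfolding r_def by simp
    have x: "x \<in> carrier_vec m" unfolding x_def using T' r by simp
    have Tx: "T *\<^sub>v x = r" unfolding x_def using assoc_mult_mat_vec[OF T T'(1) r] T'(2) r by simp
    have "cmod (x $ a) \<le> 1" if a: "a < m" for a
    proof -
      \<comment> \<open>Replacing column \<open>a\<close> of \<open>T\<close> by row
        \<open>i\<close> of \<open>w\<close> gives the transposed matrix of the choice
        \<open>f(a := i)\<close>, so the modulus of \<open>x $ a\<close> is the ratio of its minor
        to the maximal one.\<close>
      have "replace_col T r a = mat m m (\<lambda>(b, a'). w ((f(a := i)) a') b)"
        unfolding replace_col_def T_def r_def by (intro eq_matI) auto
      then have "minor (f(a := i)) = cmod (det (replace_col T r a))" by (simp only: detT)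
      also have "\<dots> = cmod (x $ a) * minor f"
        using cramer_lemma_mat[OF T x a] detT[of f] unfolding Tx by (simp add: norm_mult T_def)
      finally have "minor (f(a := i)) = cmod (x $ a) * minor f" .
      moreover have "minor (f(a := i)) \<le> minor f" using fN i by (intro maxi) auto
      ultimately show ?thesis using pos by simp
    qed
    moreover have "w i b = (\<Sum>a<m. x $ a * w (f a) b)" if "b < m" for b
    proof -
      have "w i b = (T *\<^sub>v x) $ b" unfolding Tx r_def using that by simp
      also have "\<dots> = (\<Sum>a<m. x $ a * w (f a) b)"
        using that x by (auto simp: T_def scalar_prod_def atLeast0LessThan intro!: sum.cong)
      finally show ?thesis .
    qed
    ultimately show ?thesis by (intro exI[of _ "\<lambda>a. x $ a"]) auto
  qed
  show ?thesis
  proof (rule that[OF injf])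
    show "f ` {..<m} \<subseteq> {..<N}" using fN by auto
    fix y :: "nat \<Rightarrow> complex"
    define u where "u i = (\<Sum>b<m. w i b * y b)" for i
    have ub: "(cmod (u i))\<^sup>2 \<le> real m * (\<Sum>a<m. (cmod (u (f a)))\<^sup>2)" if i: "i < N" for i
    proof -
      obtain x where x1: "\<And>a. a < m \<Longrightarrow> cmod (x a) \<le> 1"
        and x: "\<And>b. b < m \<Longrightarrow> w i b = (\<Sum>a<m. x a * w (f a) b)" using comb[OF i] by blast
      have "u i = (\<Sum>b<m. \<Sum>a<m. x a * w (f a) b * y b)"
        unfolding u_def by (simp add: x sum_distrib_right)
      also have "\<dots> = (\<Sum>a<m. \<Sum>b<m. x a * w (f a) b * y b)" by (rule sum.swap)
      also have "\<dots> = (\<Sum>a<m. x a * u (f a))"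
        unfolding u_def by (simp add: sum_distrib_left mult.assoc)
      finally have "(cmod (u i))\<^sup>2 \<le> real m * (\<Sum>a<m. (cmod (x a * u (f a)))\<^sup>2)"
        using norm_sum_squared_le[of "\<lambda>a. x a * u (f a)" m] by simp
      also have "\<dots> \<le> real m * (\<Sum>a<m. (cmod (u (f a)))\<^sup>2)"
      proof (intro mult_left_mono sum_mono power_mono)
        show "cmod (x a * u (f a)) \<le> cmod (u (f a))" if "a \<in> {..<m}" for a
          using mult_right_mono[OF x1[of a], of "cmod (u (f a))"] that by (simp add: norm_mult)
      qed auto
      finally show ?thesis .
    qed
    have "(\<Sum>i<N. (cmod (u i))\<^sup>2) \<le> real N * (real m * (\<Sum>a<m. (cmod (u (f a)))\<^sup>2))"
      using sum_bounded_above[of "{..<N}" "\<lambda>i. (cmod (u i))\<^sup>2"] ub by simp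
    from mult_left_mono[OF this c] inj[of y]
    show "(\<Sum>b<m. (cmod (y b))\<^sup>2) \<le> c * real m * real N * (\<Sum>a<m. (cmod (\<Sum>b<m. w (f a) b * y b))\<^sup>2)"
      unfolding u_def by (simp add: mult_ac)
  qed
qed

text \<open>A square matrix and its adjoint have the same singular values. Directly: solve U x = z;
  then |z|^2 is the inner product of the adjoint image of z with x, and Cauchy-Schwarz together with
  |x|^2 \<le> c |z|^2 gives the bound.\<close>

lemma adjoint_lower_bound:
  fixes u :: "nat \<Rightarrow> nat \<Rightarrow> complex"
  assumes bound: "\<And>y. (\<Sum>b<m. (cmod (y b))\<^sup>2) \<le> c * (\<Sum>a<m. (cmod (\<Sum>b<m. u a b * y b))\<^sup>2)"
    and c: "c \<ge> 0"
  shows "(\<Sum>a<m. (cmod (z a))\<^sup>2) \<le> c * (\<Sum>b<m. (cmod (\<Sum>a<m. cnj (u a b) * z a))\<^sup>2)"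
proof -
  define U where "U = mat m m (\<lambda>(a, b). u a b)"
  have U: "U \<in> carrier_mat m m" unfolding U_def by simp
  have Uv: "(U *\<^sub>v v) $ a = (\<Sum>b<m. u a b * v $ b)" if "v \<in> carrier_vec m" "a < m" for v a
    using that by (auto simp: U_def scalar_prod_def atLeast0LessThan)
  have "det U \<noteq> 0"
  proof
    assume "det U = 0"
    then obtain v where v: "v \<in> carrier_vec m" "v \<noteq> 0\<^sub>v m" "U *\<^sub>v v = 0\<^sub>v m"
      using det_0_iff_vec_prod_zero[OF U] by auto
    then have "(\<Sum>b<m. u a b * v $ b) = 0" if "a < m" for a using Uv[OF v(1) that] that by simp
    then have "(\<Sum>b<m. (cmod (v $ b))\<^sup>2) \<le> 0" using bound[of "\<lambda>b. v $ b"] by simp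
    then have "(\<Sum>b<m. (cmod (v $ b))\<^sup>2) = 0" by (intro antisym sum_nonneg) auto
    then have "\<forall>b<m. v $ b = 0" by (subst (asm) sum_nonneg_eq_0_iff) auto
    then show False using v(1,2) by auto
  qed
  then obtain U' where U': "U' \<in> carrier_mat m m" "U * U' = 1\<^sub>m m"
    using det_non_zero_imp_unit[OF U, where b = "()"] unfolding Units_def ring_mat_def by auto
  define x where "x b = (U' *\<^sub>v vec m z) $ b" for b
  have x: "(\<Sum>b<m. u a b * x b) = z a" if "a < m" for a
    using Uv[of "U' *\<^sub>v vec m z" a] assoc_mult_mat_vec[OF U U'(1), of "vec m z"] U' that
    by (simp add: x_def)
  define v where "v b = (\<Sum>a<m. cnj (u a b) * z a)" for b
  define Z where "Z = (\<Sum>a<m. (cmod (z a))\<^sup>2)"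
  have Z0: "Z \<ge> 0" unfolding Z_def by (intro sum_nonneg) auto
  have V0: "(\<Sum>b<m. (cmod (v b))\<^sup>2) \<ge> 0" by (intro sum_nonneg) auto
  have "complex_of_real Z = (\<Sum>a<m. z a * cnj (\<Sum>b<m. u a b * x b))"
    unfolding Z_def of_real_sum complex_norm_square by (simp add: x)
  also have "\<dots> = (\<Sum>a<m. \<Sum>b<m. cnj (u a b) * z a * cnj (x b))"
    by (simp add: sum_distrib_left mult_ac)
  also have "\<dots> = (\<Sum>b<m. v b * cnj (x b))"
    by (subst sum.swap) (simp add: v_def sum_distrib_right)
  finally have "Z = cmod (\<Sum>b<m. v b * cnj (x b))" using Z0 by (metis abs_of_nonneg norm_of_real)
  also have "\<dots> \<le> (\<Sum>b<m. cmod (v b) * cmod (x b))"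
    by (rule order_trans[OF norm_sum]) (simp add: norm_mult)
  finally have "Z\<^sup>2 \<le> (\<Sum>b<m. cmod (v b) * cmod (x b))\<^sup>2" using Z0 by (intro power_mono) auto
  also have "\<dots> \<le> (\<Sum>b<m. (cmod (v b))\<^sup>2) * (\<Sum>b<m. (cmod (x b))\<^sup>2)"
    by (rule Cauchy_Schwarz_ineq_sum)
  also have "\<dots> \<le> (\<Sum>b<m. (cmod (v b))\<^sup>2) * (c * Z)"
    using bound[of x] V0 by (intro mult_left_mono) (auto simp: x Z_def)
  finally have "Z * Z \<le> (c * (\<Sum>b<m. (cmod (v b))\<^sup>2)) * Z" by (simp add: power2_eq_square mult_ac)
  then have "Z \<le> c * (\<Sum>b<m. (cmod (v b))\<^sup>2)"
    using Z0 V0 c by (cases "Z = 0") auto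
  then show ?thesis unfolding Z_def v_def .
qed

text \<open>Padding the system with zero rows gives a singular square matrix, whose kernel supplies
  \<open>z\<close>. Being nonzero is expressed through a sum of squares because \<open>z\<close> is
  a function on all naturals and only its first \<open>m\<close> values form the vector.\<close>

lemma underdetermined_system:
  fixes q :: "nat \<Rightarrow> nat \<Rightarrow> complex"
  assumes I: "finite I" "card I < m"
  shows "\<exists>z. (\<Sum>a<m. (cmod (z a))\<^sup>2) > 0 \<and> (\<forall>i\<in>I. (\<Sum>a<m. q i a * z a) = 0)"
proof -
  obtain e where e: "bij_betw e {..<card I} I"
    using ex_bij_betw_nat_finite[OF I(1)] by (auto simp: atLeast0LessThan)
  define Q where "Q = mat m m (\<lambda>(i, a). if i < card I then q (e i) a else 0)"
  have Q: "Q \<in> carrier_mat m m" unfolding Q_def by simp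
  have "det Q = 0"
  proof (rule ccontr)
    assume "det Q \<noteq> 0"
    then obtain Q' where Q': "Q' \<in> carrier_mat m m" "Q * Q' = 1\<^sub>m m"
      using det_non_zero_imp_unit[OF Q, where b = "()"] unfolding Units_def ring_mat_def by auto
    \<comment> \<open>Row \<open>card I\<close> is the first padding row; it exists because
      \<open>card I < m\<close>, and being zero it rules out a right inverse.\<close>
    have "(Q * Q') $$ (card I, card I) = (\<Sum>a<m. Q $$ (card I, a) * Q' $$ (a, card I))"
      using Q Q'(1) I by (simp add: scalar_prod_def atLeast0LessThan)
    also have "\<dots> = 0" using I by (simp add: Q_def)
    finally show False using Q'(2) I by simp
  qed
  then obtain v where v: "v \<in> carrier_vec m" "v \<noteq> 0\<^sub>v m" "Q *\<^sub>v v = 0\<^sub>v m"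
    using det_0_iff_vec_prod_zero[OF Q] by auto
  show ?thesis
  proof (intro exI[of _ "\<lambda>a. v $ a"] conjI ballI)
    obtain b where b: "b < m" "v $ b \<noteq> 0" using v(1,2) by (metis carrier_vecD eq_vecI index_zero_vec)
    then show "(\<Sum>a<m. (cmod (v $ a))\<^sup>2) > 0" by (intro sum_pos2[of _ b]) auto
    fix i assume "i \<in> I"
    then obtain k where k: "k < card I" "i = e k" using e by (auto simp: bij_betw_def)
    have "(\<Sum>a<m. q i a * v $ a) = (Q *\<^sub>v v) $ k"
      using k I v(1) by (auto simp: Q_def scalar_prod_def atLeast0LessThan)
    then show "(\<Sum>a<m. q i a * v $ a) = 0" using v(3) k I by simp
  qed
qed

section \<open>Vectors supported on selected indices\<close>

text \<open>A general \<open>G\<close> with \<open>G j 0 = 0\<close> lets one statement cover both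
  linear forms and squared norms.\<close>

lemma sum_inv_into_extension:
  fixes G :: "'i \<Rightarrow> 'v :: zero \<Rightarrow> 'w :: comm_monoid_add"
  assumes f: "inj_on f I" "f ` I \<subseteq> J" and J: "finite J" and G: "\<And>j. G j 0 = 0"
  shows "(\<Sum>j\<in>J. G j (if j \<in> f ` I then z (inv_into I f j) else 0)) = (\<Sum>a\<in>I. G (f a) (z a))"
proof -
  have "(\<Sum>j\<in>J. G j (if j \<in> f ` I then z (inv_into I f j) else 0)) =
      (\<Sum>j\<in>f ` I. G j (z (inv_into I f j)))"
    using f(2) J G by (intro sum.mono_neutral_cong_right) auto
  also have "\<dots> = (\<Sum>a\<in>I. G (f a) (z a))" by (simp add: sum.reindex[OF f(1)] inv_into_f_f[OF f(1)])
  finally show ?thesis .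
qed

text \<open>The entries of \<open>z\<close> are placed at the positions given by \<open>f\<close>.
  The quantifier over \<open>g\<close> stands inside the existential so that a single
  \<open>y\<close> serves all linear forms, such as all rows of a matrix.\<close>

lemma extend_by_zero:
  fixes z :: "nat \<Rightarrow> complex" and f :: "nat \<Rightarrow> nat"
  assumes f: "inj_on f {..<m}" "f ` {..<m} \<subseteq> {..<n}"
  shows "\<exists>y. (\<forall>g. (\<Sum>j<n. g j * y j) = (\<Sum>a<m. g (f a) * z a)) \<and>
    (\<Sum>j<n. (cmod (y j))\<^sup>2) = (\<Sum>a<m. (cmod (z a))\<^sup>2)"
  using sum_inv_into_extension[OF f, of "\<lambda>j v. _ j * v" z]
    sum_inv_into_extension[OF f, of "\<lambda>_ v. (cmod v)\<^sup>2" z]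
  by (intro exI[of _ "\<lambda>j. if j \<in> f ` {..<m} then z (inv_into {..<m} f j) else 0"]) simp_all

section \<open>Lower bounds for an inverse and small eigenvalues\<close>

text \<open>Multiplying u M = \<mu> u by \<open>H\<close> on the right gives u = \<mu> u H, here
  evaluated at \<open>y\<close>. Without division by \<mu> it also covers \<mu> = 0.\<close>

lemma eigenvector_row_inverse:
  fixes M H :: "complex mat"
  assumes M: "M \<in> carrier_mat n n" and H: "H \<in> carrier_mat n n" and MH: "M * H = 1\<^sub>m n"
    and ev: "\<And>k. k < n \<Longrightarrow> (\<Sum>j<n. u j * M $$ (j, k)) = \<mu> * u k"
  shows "(\<Sum>j<n. u j * y j) = \<mu> * (\<Sum>k<n. u k * (\<Sum>j<n. H $$ (k, j) * y j))"
proof -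
  have MHi: "(\<Sum>k<n. M $$ (i, k) * H $$ (k, j)) = (if i = j then 1 else 0)" if "i < n" "j < n" for i j
    using arg_cong[OF MH, of "\<lambda>X. X $$ (i, j)"] M H that by (auto simp: scalar_prod_def atLeast0LessThan)
  have "\<mu> * (\<Sum>k<n. u k * (\<Sum>j<n. H $$ (k, j) * y j)) = (\<Sum>k<n. (\<Sum>i<n. u i * M $$ (i, k)) * (\<Sum>j<n. H $$ (k, j) * y j))"
    unfolding sum_distrib_left by (intro sum.cong refl) (simp add: ev sum_distrib_left mult_ac)
  also have "\<dots> = (\<Sum>k<n. \<Sum>i<n. \<Sum>j<n. u i * M $$ (i, k) * (H $$ (k, j) * y j))"
    by (simp add: sum_product)
  also have "\<dots> = (\<Sum>i<n. \<Sum>j<n. \<Sum>k<n. u i * M $$ (i, k) * (H $$ (k, j) * y j))"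
    by (subst sum.swap) (intro sum.cong refl sum.swap)
  also have "\<dots> = (\<Sum>i<n. \<Sum>j<n. u i * y j * (\<Sum>k<n. M $$ (i, k) * H $$ (k, j)))"
    unfolding sum_distrib_left by (intro sum.cong refl) (simp add: mult_ac)
  also have "\<dots> = (\<Sum>i<n. \<Sum>j<n. if j = i then u i * y i else 0)"
    by (intro sum.cong refl) (simp add: MHi)
  also have "\<dots> = (\<Sum>i<n. u i * y i)" by simp
  finally show ?thesis by simp
qed

lemma sum_inj_on_le:
  fixes F :: "nat \<Rightarrow> real"
  assumes "inj_on h {..<m}" "h ` {..<m} \<subseteq> {..<n}" "\<And>i. F i \<ge> 0"
  shows "(\<Sum>b<m. F (h b)) \<le> (\<Sum>i<n. F i)"
proof -
  have "(\<Sum>b<m. F (h b)) = (\<Sum>i\<in>h ` {..<m}. F i)" by (simp add: sum.reindex[OF assms(1)])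
  also have "\<dots> \<le> (\<Sum>i<n. F i)" using assms by (intro sum_mono2) auto
  finally show ?thesis .
qed

text \<open>\<open>f\<close> selects the columns J and \<open>h\<close> the rows I. Selecting
  coordinates of the eigenvectors and then rows of the columns J of \<open>B\<close> each cost a
  factor \<open>m * N\<close> in the squared bound; the eigenvalues contribute
  \<open>c\<^sup>2\<close>.\<close>

lemma well_conditioned_submatrix_of_inverse:
  fixes A B :: "complex mat"
  assumes A: "A \<in> carrier_mat N N" and herm: "mat_adjoint A = A"
    and B: "B \<in> carrier_mat N N" and AB: "A * B = 1\<^sub>m N"
    and count: "m \<le> eig_count \<epsilon> A" and \<epsilon>: "\<epsilon> > 0"
  shows "\<exists>f h c. inj_on f {..<m} \<and> f ` {..<m} \<subseteq> {..<N} \<and> inj_on h {..<m} \<and> h ` {..<m} \<subseteq> {..<N} \<and>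
    0 \<le> c \<and> c < \<epsilon> \<and>
    (\<forall>z. (\<Sum>a<m. (cmod (z a))\<^sup>2) \<le>
       (real m * real N * c)\<^sup>2 * (\<Sum>b<m. (cmod (\<Sum>a<m. B $$ (h b, f a) * z a))\<^sup>2))"
proof -
  obtain w and d where
    w: "\<And>y. (\<Sum>i<N. (cmod (\<Sum>j<N. w i j * y j))\<^sup>2) = (\<Sum>j<N. (cmod (y j))\<^sup>2)"
    and w': "\<And>y. (\<Sum>j<N. (cmod (\<Sum>i<N. cnj (w i j) * y i))\<^sup>2) = (\<Sum>i<N. (cmod (y i))\<^sup>2)"
    and ev: "\<forall>i<N. \<forall>k<N. (\<Sum>j<N. w i j * A $$ (j, k)) = of_real (d i) * w i k"
    and cnt: "\<And>\<delta>. eig_count \<delta> A = card {i. i < N \<and> \<bar>d i\<bar> < \<delta>}"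
    using hermitian_spectral[OF A herm] by blast
  obtain S where S: "S \<subseteq> {i. i < N \<and> \<bar>d i\<bar> < \<epsilon>}" "card S = m" "finite S"
    using obtain_subset_with_card_n[OF count[unfolded cnt]] by blast
  obtain g where g: "bij_betw g {..<m} S"
    using ex_bij_betw_nat_finite[OF S(3)] S(2) by (auto simp: atLeast0LessThan)
  have ginj: "inj_on g {..<m}" and gN: "g ` {..<m} \<subseteq> {..<N}"
    using g S by (auto simp: bij_betw_def)
  \<comment> \<open>The largest modulus among the finitely many chosen eigenvalues is still strictly
    below \<epsilon>. Inserting 0 makes the maximum defined even for an empty set and gives
    \<open>c \<ge> 0\<close>.\<close>
  define c where "c = Max (insert 0 ((\<lambda>i. \<bar>d i\<bar>) ` S))"
  have c0: "c \<ge> 0" unfolding c_def using S by (intro Max_ge) auto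
  have c\<epsilon>: "c < \<epsilon>" unfolding c_def using S \<epsilon> by (subst Max_less_iff) auto
  have dc: "\<bar>d (g b)\<bar> \<le> c" if "b < m" for b
    unfolding c_def using S g that by (intro Max_ge) (auto simp: bij_betw_def)
  \<comment> \<open>The conjugated rows \<open>w (g b)\<close> are the chosen eigenvectors; as
    orthonormal columns they form an isometry, so the row selection starts from the constant
    1.\<close>
  have iso: "(\<Sum>b<m. (cmod (y b))\<^sup>2) \<le> 1 * (\<Sum>i<N. (cmod (\<Sum>b<m. cnj (w (g b) i) * y b))\<^sup>2)" for y
  proof -
    obtain Y where Y: "\<And>k. (\<Sum>j<N. k j * Y j) = (\<Sum>b<m. k (g b) * y b)"
      "(\<Sum>j<N. (cmod (Y j))\<^sup>2) = (\<Sum>b<m. (cmod (y b))\<^sup>2)"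
      using extend_by_zero[OF ginj gN] by blast
    show ?thesis using w'[of Y] unfolding Y by simp
  qed
  obtain f where f: "inj_on f {..<m}" "f ` {..<m} \<subseteq> {..<N}"
    and fb: "\<And>y. (\<Sum>b<m. (cmod (y b))\<^sup>2) \<le> 1 * real m * real N *
      (\<Sum>a<m. (cmod (\<Sum>b<m. cnj (w (g b) (f a)) * y b))\<^sup>2)"
    using well_conditioned_row_selection[where c = 1 and w = "\<lambda>i b. cnj (w (g b) i)", OF iso] by auto
  have bound: "(\<Sum>a<m. (cmod (z a))\<^sup>2) \<le>
      real m * real N * c\<^sup>2 * (\<Sum>i<N. (cmod (\<Sum>a<m. B $$ (i, f a) * z a))\<^sup>2)" for z
  proof -
    obtain y where y: "\<And>k. (\<Sum>j<N. k j * y j) = (\<Sum>a<m. k (f a) * z a)"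
      using extend_by_zero[OF f] by blast
    define x where "x i = (\<Sum>a<m. B $$ (i, f a) * z a)" for i
    define t where "t i = (\<Sum>k<N. w i k * x k)" for i
    \<comment> \<open>The eigenvector coefficients of \<open>y\<close> are those of
      \<open>x\<close>, which is \<open>B\<close> applied to \<open>y\<close>, times the eigenvalues
      of \<open>A\<close>; for the chosen eigenvectors these are at most \<open>c\<close> in
      modulus.\<close>
    have wd: "(\<Sum>a<m. w i (f a) * z a) = of_real (d i) * t i" if "i < N" for i
      using eigenvector_row_inverse[OF A B AB ev[rule_format, OF that], of y] unfolding y x_def t_def by simp
    \<comment> \<open>The selection bounds the chosen submatrix on combinations of eigenvectors; its
      adjoint acts on vectors supported on J, which are the ones to be estimated.\<close>
    have "(\<Sum>a<m. (cmod (z a))\<^sup>2) \<le> real m * real N * (\<Sum>b<m. (cmod (\<Sum>a<m. w (g b) (f a) * z a))\<^sup>2)"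
      using adjoint_lower_bound[of m "real m * real N" "\<lambda>a b. cnj (w (g b) (f a))" z] fb by simp
    also have "\<dots> \<le> real m * real N * (\<Sum>b<m. c\<^sup>2 * (cmod (t (g b)))\<^sup>2)"
    proof (intro mult_left_mono sum_mono)
      fix b assume "b \<in> {..<m}"
      then have "g b < N" "(d (g b))\<^sup>2 \<le> c\<^sup>2" using gN dc[of b] by (auto simp: abs_le_square_iff[symmetric])
      then show "(cmod (\<Sum>a<m. w (g b) (f a) * z a))\<^sup>2 \<le> c\<^sup>2 * (cmod (t (g b)))\<^sup>2"
        by (simp add: wd norm_mult power_mult_distrib mult_right_mono)
    qed auto
    also have "\<dots> = real m * real N * c\<^sup>2 * (\<Sum>b<m. (cmod (t (g b)))\<^sup>2)"
      by (simp add: sum_distrib_left mult_ac)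
    \<comment> \<open>Passing to all eigenvectors only enlarges the sum, and unitarity of
      \<open>w\<close> then turns it into |x|^2.\<close>
    also have "\<dots> \<le> real m * real N * c\<^sup>2 * (\<Sum>i<N. (cmod (t i))\<^sup>2)"
      by (intro mult_left_mono sum_inj_on_le[OF ginj gN]) auto
    also have "(\<Sum>i<N. (cmod (t i))\<^sup>2) = (\<Sum>i<N. (cmod (x i))\<^sup>2)"
      unfolding t_def by (rule w)
    finally show ?thesis unfolding x_def .
  qed
  obtain h where h: "inj_on h {..<m}" "h ` {..<m} \<subseteq> {..<N}"
    and hb: "\<And>z. (\<Sum>a<m. (cmod (z a))\<^sup>2) \<le> real m * real N * c\<^sup>2 * real m * real N *
      (\<Sum>b<m. (cmod (\<Sum>a<m. B $$ (h b, f a) * z a))\<^sup>2)"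
    using well_conditioned_row_selection[where c = "real m * real N * c\<^sup>2" and w = "\<lambda>i a. B $$ (i, f a)", OF bound]
    by auto
  have "real m * real N * c\<^sup>2 * real m * real N = (real m * real N * c)\<^sup>2"
    by (simp add: power2_eq_square)
  then show ?thesis using f h c0 c\<epsilon> hb by (intro exI[of _ f] exI[of _ h] exI[of _ c]) simp
qed

text \<open>By a dimension count, too few small eigenvalues would leave a nonzero \<open>y\<close>,
  supported on the image of \<open>f\<close>, orthogonal to their eigenvectors. Then \<delta> |H y|
  \<le> |y| \<le> c |H y| although c < \<delta>.\<close>

lemma eig_count_inverse_ge:
  fixes G H :: "complex mat"
  assumes G: "G \<in> carrier_mat n n" and herm: "mat_adjoint G = G"
    and H: "H \<in> carrier_mat n n" and GH: "G * H = 1\<^sub>m n"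
    and f: "inj_on f {..<m}" "f ` {..<m} \<subseteq> {..<n}"
    and bound: "\<And>z. (\<Sum>a<m. (cmod (z a))\<^sup>2) \<le> c\<^sup>2 * (\<Sum>i<n. (cmod (\<Sum>a<m. H $$ (i, f a) * z a))\<^sup>2)"
    and c: "0 \<le> c" "c < \<delta>"
  shows "m \<le> eig_count \<delta> G"
proof (rule ccontr)
  assume "\<not> m \<le> eig_count \<delta> G"
  obtain w and d where
    w: "\<And>y. (\<Sum>i<n. (cmod (\<Sum>j<n. w i j * y j))\<^sup>2) = (\<Sum>j<n. (cmod (y j))\<^sup>2)"
    and ev: "\<forall>i<n. \<forall>k<n. (\<Sum>j<n. w i j * G $$ (j, k)) = of_real (d i) * w i k"
    and cnt: "\<And>\<delta>. eig_count \<delta> G = card {i. i < n \<and> \<bar>d i\<bar> < \<delta>}"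
    using hermitian_spectral[OF G herm] by blast
  have "card {i. i < n \<and> \<bar>d i\<bar> < \<delta>} < m" using \<open>\<not> m \<le> eig_count \<delta> G\<close> unfolding cnt by simp
  then obtain z where z0: "(\<Sum>a<m. (cmod (z a))\<^sup>2) > 0"
    and zI: "\<forall>i\<in>{i. i < n \<and> \<bar>d i\<bar> < \<delta>}. (\<Sum>a<m. w i (f a) * z a) = 0"
    using underdetermined_system[of "{i. i < n \<and> \<bar>d i\<bar> < \<delta>}" m "\<lambda>i a. w i (f a)"] by auto
  have z: "(\<Sum>a<m. w i (f a) * z a) = 0" if "i < n" "\<bar>d i\<bar> < \<delta>" for i using zI that by blast
  obtain y where y: "\<And>k. (\<Sum>j<n. k j * y j) = (\<Sum>a<m. k (f a) * z a)"
    and ynorm: "(\<Sum>j<n. (cmod (y j))\<^sup>2) = (\<Sum>a<m. (cmod (z a))\<^sup>2)"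
    using extend_by_zero[OF f] by blast
  define x where "x i = (\<Sum>j<n. H $$ (i, j) * y j)" for i
  define t where "t i = (\<Sum>k<n. w i k * x k)" for i
  have wd: "(\<Sum>j<n. w i j * v j) = of_real (d i) * (\<Sum>k<n. w i k * (\<Sum>j<n. H $$ (k, j) * v j))"
    if "i < n" for i v
    using eigenvector_row_inverse[OF G H GH ev[rule_format, OF that], of v] .
  have "\<delta>\<^sup>2 * (cmod (t i))\<^sup>2 \<le> (cmod (\<Sum>j<n. w i j * y j))\<^sup>2" if i: "i < n" for i
  proof (cases "\<bar>d i\<bar> < \<delta>")
    case True
    have "of_real (d i) * t i = 0"
      using z[OF i True] wd[OF i, of y] unfolding y[of "w i"] t_def x_def by simp
    \<comment> \<open>The vanishing product leaves the case \<open>d i = 0\<close> open; there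
      \<open>wd\<close> applied to \<open>x\<close> instead of \<open>y\<close> gives
      \<open>t i = 0\<close>.\<close>
    moreover have "t i = 0" if "d i = 0" using wd[OF i, of x] that unfolding t_def by simp
    ultimately show ?thesis by auto
  next
    case False
    then have "\<delta>\<^sup>2 \<le> (d i)\<^sup>2" using c by (auto simp: abs_le_square_iff[symmetric])
    then show ?thesis unfolding wd[OF i, of y] t_def x_def
      by (simp add: norm_mult power_mult_distrib mult_right_mono)
  qed
  then have "(\<Sum>i<n. \<delta>\<^sup>2 * (cmod (t i))\<^sup>2) \<le> (\<Sum>i<n. (cmod (\<Sum>j<n. w i j * y j))\<^sup>2)"
    by (intro sum_mono) auto
  then have "\<delta>\<^sup>2 * (\<Sum>i<n. (cmod (x i))\<^sup>2) \<le> (\<Sum>a<m. (cmod (z a))\<^sup>2)"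
    unfolding w ynorm sum_distrib_left[symmetric] t_def .
  also have "\<dots> \<le> c\<^sup>2 * (\<Sum>i<n. (cmod (x i))\<^sup>2)"
    using bound[of z] unfolding x_def y .
  finally have le: "\<delta>\<^sup>2 * (\<Sum>i<n. (cmod (x i))\<^sup>2) \<le> c\<^sup>2 * (\<Sum>i<n. (cmod (x i))\<^sup>2)" .
  \<comment> \<open>Since \<open>z\<close> is nonzero, \<open>bound\<close> makes the norm of
    \<open>x\<close> positive, so it can be cancelled from \<open>le\<close>.\<close>
  have "0 < c\<^sup>2 * (\<Sum>i<n. (cmod (x i))\<^sup>2)" using z0 bound[of z] unfolding x_def y by linarith
  then have "0 < (\<Sum>i<n. (cmod (x i))\<^sup>2)" by (simp add: zero_less_mult_iff)
  with le have "\<delta>\<^sup>2 \<le> c\<^sup>2" by simp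
  moreover have "c\<^sup>2 < \<delta>\<^sup>2" using c by (intro power_strict_mono) auto
  ultimately show False by simp
qed

section \<open>Inverses and principal submatrices\<close>

text \<open>\<open>mat_inverse\<close> is specified through the units of the matrix ring, so the
  inverse supplied by \<open>invertible_mat\<close>, whose dimensions are read off from the two
  products, is first placed there. Hence \<open>the\<close> in \<open>inv_mat\<close> meets a
  \<open>Some\<close>.\<close>

lemma inv_mat_inverse:
  assumes M: "M \<in> carrier_mat n n" and inv: "invertible_mat M"
  shows "inv_mat M \<in> carrier_mat n n" "M * inv_mat M = 1\<^sub>m n" "inv_mat M * M = 1\<^sub>m n"
proof -
  obtain B where B: "M * B = 1\<^sub>m n" "B * M = 1\<^sub>m (dim_row B)"
    using inv M unfolding invertible_mat_def inverts_mat_def by auto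
  have "dim_col B = n" using arg_cong[OF B(1), of dim_col] by simp
  moreover have "dim_row B = n" using arg_cong[OF B(2), of dim_col] M by simp
  ultimately have "B \<in> carrier_mat n n" by auto
  then have "M \<in> Units (ring_mat TYPE(complex) n ())"
    using M B unfolding Units_def ring_mat_def by auto
  then obtain C where "mat_inverse M = Some C"
    using mat_inverse(1)[OF M, where b = "()"] by (cases "mat_inverse M") auto
  then show "inv_mat M \<in> carrier_mat n n" "M * inv_mat M = 1\<^sub>m n" "inv_mat M * M = 1\<^sub>m n"
    using mat_inverse(2)[OF M] unfolding inv_mat_def by auto
qed

lemma inv_mat_unique:
  assumes M: "M \<in> carrier_mat n n" and B: "B \<in> carrier_mat n n" and MB: "M * B = 1\<^sub>m n"
  shows "invertible_mat M" "inv_mat M = B"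
proof -
  have BM: "B * M = 1\<^sub>m n" using mat_mult_left_right_inverse[OF M B MB] .
  show inv: "invertible_mat M"
    using M B MB BM unfolding invertible_mat_def inverts_mat_def by auto
  have "inv_mat M = inv_mat M * (M * B)" using inv_mat_inverse[OF M inv] MB by simp
  also have "\<dots> = (inv_mat M * M) * B" using inv_mat_inverse(1)[OF M inv] M B by simp
  finally show "inv_mat M = B" using inv_mat_inverse(3)[OF M inv] B by simp
qed

lemma inv_mat_hermitian:
  assumes M: "M \<in> carrier_mat n n" and inv: "invertible_mat M" and herm: "mat_adjoint M = M"
  shows "mat_adjoint (inv_mat M) = inv_mat M"
proof -
  have "M * mat_adjoint (inv_mat M) = 1\<^sub>m n"
    using mat_adjoint_mult[OF inv_mat_inverse(1)[OF M inv] M] inv_mat_inverse(3)[OF M inv] herm by simp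
  from inv_mat_unique(2)[OF M mat_adjoint_carrier[OF inv_mat_inverse(1)[OF M inv]] this]
  show ?thesis by (rule sym)
qed

text \<open>\<open>pick \<gamma> i\<close> is the \<open>i\<close>-th element of \<gamma> in
  increasing order, counted from 0; as \<gamma> lies within the index range,
  \<open>submatrix\<close> drops none of its elements.\<close>

lemma principal_submatrix_entries:
  assumes B: "B \<in> carrier_mat N N" and \<gamma>: "\<gamma> \<subseteq> {..<N}"
  shows "principal_submatrix B \<gamma> \<in> carrier_mat (card \<gamma>) (card \<gamma>)"
    "\<And>i j. i < card \<gamma> \<Longrightarrow> j < card \<gamma> \<Longrightarrow> principal_submatrix B \<gamma> $$ (i, j) = B $$ (pick \<gamma> i, pick \<gamma> j)"
proof -
  have "{i. i < N \<and> i \<in> \<gamma>} = \<gamma>" using \<gamma> by auto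
  then show "principal_submatrix B \<gamma> \<in> carrier_mat (card \<gamma>) (card \<gamma>)"
    "\<And>i j. i < card \<gamma> \<Longrightarrow> j < card \<gamma> \<Longrightarrow> principal_submatrix B \<gamma> $$ (i, j) = B $$ (pick \<gamma> i, pick \<gamma> j)"
    using B unfolding principal_submatrix_def submatrix_def by auto
qed

lemma principal_submatrix_hermitian:
  assumes B: "B \<in> carrier_mat N N" and \<gamma>: "\<gamma> \<subseteq> {..<N}" and herm: "mat_adjoint B = B"
  shows "mat_adjoint (principal_submatrix B \<gamma>) = principal_submatrix B \<gamma>"
proof (rule eq_matI)
  note P = principal_submatrix_entries[OF B \<gamma>]
  fix i j assume "i < dim_row (principal_submatrix B \<gamma>)" "j < dim_col (principal_submatrix B \<gamma>)"
  then have i: "i < card \<gamma>" and j: "j < card \<gamma>" using P(1) by auto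
  then have "pick \<gamma> i < N" "pick \<gamma> j < N" using pick_in_set_le \<gamma> by blast+
  then have "B $$ (pick \<gamma> i, pick \<gamma> j) = cnj (B $$ (pick \<gamma> j, pick \<gamma> i))"
    using arg_cong[OF herm, of "\<lambda>X. X $$ (pick \<gamma> i, pick \<gamma> j)"] B by simp
  then show "mat_adjoint (principal_submatrix B \<gamma>) $$ (i, j) = principal_submatrix B \<gamma> $$ (i, j)"
    using i j P by simp
qed (use principal_submatrix_entries(1)[OF B \<gamma>] in auto)

lemma principal_submatrix_full:
  assumes B: "B \<in> carrier_mat N N"
  shows "principal_submatrix B {..<N} = B"
proof (rule eq_matI)
  \<comment> \<open>An initial segment enumerates itself: exactly \<open>i\<close> of its elements
    lie below \<open>i\<close>.\<close>
  have pick: "pick {..<N} i = i" if "i < N" for i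
  proof -
    have "{a \<in> {..<N}. a < i} = {..<i}" using that by auto
    then show ?thesis using pick_card_in_set[of i "{..<N}"] that by simp
  qed
  fix i j assume "i < dim_row B" "j < dim_col B"
  then show "principal_submatrix B {..<N} $$ (i, j) = B $$ (i, j)"
    using principal_submatrix_entries(2)[OF B order_refl] B by (simp add: pick)
qed (use principal_submatrix_entries(1)[OF B order_refl] B in auto)

section \<open>Small eigenvalues of \<open>A\<close> and of inverses of principal
  submatrices\<close>

text \<open>The forward implication carries \<open>2 * m \<le> N\<close> because only then does
  \<open>{..<N}\<close> contain a subset with \<open>2 * m\<close> elements.\<close>

theorem corollary1p2:
  fixes A :: "complex mat" and N m :: nat and \<epsilon> :: real
  assumes "A \<in> carrier_mat N N"
    and "mat_adjoint A = A"
    and "invertible_mat A"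
    and "m > 0"
    and "\<epsilon> > 0"
  shows "(2 * m \<le> N \<longrightarrow> eig_count \<epsilon> A \<ge> m \<longrightarrow>
            submatrix_inverse_condition N A m \<epsilon> (C_const m / real N))
       \<and> (submatrix_inverse_condition N A m \<epsilon> 1 \<longrightarrow> eig_count \<epsilon> A \<ge> m)"
proof (intro conjI impI)
  note A = assms(1) and herm = assms(2) and inv = assms(3)
  define B where "B = inv_mat A"
  have B: "B \<in> carrier_mat N N" and AB: "A * B = 1\<^sub>m N" and BA: "B * A = 1\<^sub>m N"
    unfolding B_def using inv_mat_inverse[OF A inv] by auto
  have Bherm: "mat_adjoint B = B" unfolding B_def by (rule inv_mat_hermitian[OF A inv herm])
  {
    assume N: "2 * m \<le> N" and count: "m \<le> eig_count \<epsilon> A"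
    obtain f h c where f: "inj_on f {..<m}" "f ` {..<m} \<subseteq> {..<N}"
      and h: "inj_on h {..<m}" "h ` {..<m} \<subseteq> {..<N}" and c: "0 \<le> c" "c < \<epsilon>"
      and bound: "\<And>z. (\<Sum>a<m. (cmod (z a))\<^sup>2) \<le>
        (real m * real N * c)\<^sup>2 * (\<Sum>b<m. (cmod (\<Sum>a<m. B $$ (h b, f a) * z a))\<^sup>2)"
      using well_conditioned_submatrix_of_inverse[OF A herm B AB count assms(5)] by blast
    let ?J = "f ` {..<m} \<union> h ` {..<m}"
    have "card ?J \<le> 2 * m"
      using card_Un_le[of "f ` {..<m}" "h ` {..<m}"] f h by (simp add: card_image)
    \<comment> \<open>The images of \<open>f\<close> and \<open>h\<close> may overlap, so their
      union is enlarged within \<open>{..<N}\<close> to exactly \<open>2 * m\<close>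
      elements.\<close>
    then obtain \<gamma>m where \<gamma>m: "?J \<subseteq> \<gamma>m" "\<gamma>m \<subseteq> {..<N}" "card \<gamma>m = 2 * m"
      using exists_subset_between[of ?J "2 * m" "{..<N}"] N f h by auto
    show "submatrix_inverse_condition N A m \<epsilon> (C_const m / real N)"
      unfolding submatrix_inverse_condition_def B_def[symmetric]
    proof (intro exI[of _ \<gamma>m] conjI allI impI)
      fix \<gamma> assume "\<gamma>m \<subseteq> \<gamma> \<and> \<gamma> \<subseteq> {..<N} \<and> invertible_mat (principal_submatrix B \<gamma>)"
      then have sub: "\<gamma>m \<subseteq> \<gamma>" and \<gamma>: "\<gamma> \<subseteq> {..<N}" and Hinv: "invertible_mat (principal_submatrix B \<gamma>)"
        by auto
      define H where "H = principal_submatrix B \<gamma>"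
      define n where "n = card \<gamma>"
      have H: "H \<in> carrier_mat n n" and Hij: "\<And>i j. i < n \<Longrightarrow> j < n \<Longrightarrow> H $$ (i, j) = B $$ (pick \<gamma> i, pick \<gamma> j)"
        unfolding H_def n_def using principal_submatrix_entries[OF B \<gamma>] by auto
      note Hinv = Hinv[folded H_def]
      have Gherm: "mat_adjoint (inv_mat H) = inv_mat H"
        using inv_mat_hermitian[OF H Hinv] principal_submatrix_hermitian[OF B \<gamma> Bherm] unfolding H_def by simp
      \<comment> \<open>\<open>idx k\<close> is the position of \<open>k\<close> within \<gamma>,
        inverse to \<open>pick \<gamma>\<close>; it translates row and column numbers of
        \<open>B\<close> into those of \<open>H\<close>.\<close>
      define idx where "idx k = card {a \<in> \<gamma>. a < k}" for k
      have pick_idx: "pick \<gamma> (idx k) = k" if "k \<in> \<gamma>" for k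
        unfolding idx_def by (rule pick_card_in_set[OF that])
      have idx_less: "idx k < n" if "k \<in> \<gamma>" for k
        unfolding idx_def n_def using that finite_subset[OF \<gamma>] by (intro psubset_card_mono) auto
      have f\<gamma>: "f a \<in> \<gamma>" and h\<gamma>: "h a \<in> \<gamma>" if "a < m" for a using that \<gamma>m(1) sub by auto
      have inj: "inj_on (\<lambda>a. idx (k a)) {..<m}" if "inj_on k {..<m}" "\<And>a. a < m \<Longrightarrow> k a \<in> \<gamma>" for k
        using that pick_idx by (intro inj_onI) (metis inj_onD lessThan_iff)
      have Hb: "B $$ (h b, f a) = H $$ (idx (h b), idx (f a))" if "a < m" "b < m" for a b
        using that by (simp add: Hij idx_less pick_idx f\<gamma> h\<gamma>)
      have Hbound: "(\<Sum>a<m. (cmod (z a))\<^sup>2) \<le>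
          (real m * real N * c)\<^sup>2 * (\<Sum>i<n. (cmod (\<Sum>a<m. H $$ (i, idx (f a)) * z a))\<^sup>2)" for z
      proof -
        have "(\<Sum>a<m. (cmod (z a))\<^sup>2) \<le> (real m * real N * c)\<^sup>2 *
            (\<Sum>b<m. (cmod (\<Sum>a<m. H $$ (idx (h b), idx (f a)) * z a))\<^sup>2)"
          using bound[of z] by (simp add: Hb)
        \<comment> \<open>The rows of \<open>H\<close> not selected by \<open>h\<close> only add
          nonnegative terms.\<close>
        also have "\<dots> \<le> (real m * real N * c)\<^sup>2 * (\<Sum>i<n. (cmod (\<Sum>a<m. H $$ (i, idx (f a)) * z a))\<^sup>2)"
          using idx_less h\<gamma> by (intro mult_left_mono sum_inj_on_le inj h(1)) auto
        finally show ?thesis .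
      qed
      have less: "real m * real N * c < \<epsilon> / (C_const m / real N)"
      proof -
        \<comment> \<open>Strictness comes from \<open>c < \<epsilon>\<close>, as
          \<open>m * N\<close> is positive; the rest multiplies \<open>m \<le> fact m\<close> by
          \<open>1 \<le> 2 ^ (m - 1)\<close>.\<close>
        have "real m * real N * c < real m * real N * \<epsilon>" using c N assms(4) by simp
        also have "real m \<le> fact m * 2 ^ (m - 1)"
          using mult_mono[of "real m" "fact m" 1 "2 ^ (m - 1)"] fact_ge_self[of m, folded of_nat_le_iff[where 'a = real]]
          by simp
        then have "real m * real N * \<epsilon> \<le> (fact m * 2 ^ (m - 1)) * real N * \<epsilon>"
          using assms(5) by (intro mult_right_mono) auto
        also have "\<dots> = \<epsilon> / (C_const m / real N)" unfolding C_const_def by simp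
        finally show ?thesis .
      qed
      have fidx: "inj_on (\<lambda>a. idx (f a)) {..<m}" "(\<lambda>a. idx (f a)) ` {..<m} \<subseteq> {..<n}"
        using inj[OF f(1) f\<gamma>] idx_less f\<gamma> by auto
      show "m \<le> eig_count (\<epsilon> / (C_const m / real N)) (inv_mat (principal_submatrix B \<gamma>))"
        unfolding H_def[symmetric]
      proof (rule eig_count_inverse_ge[OF inv_mat_inverse(1)[OF H Hinv] Gherm H inv_mat_inverse(3)[OF H Hinv] fidx])
        show "(\<Sum>a<m. (cmod (z a))\<^sup>2) \<le>
          (real m * real N * c)\<^sup>2 * (\<Sum>i<n. (cmod (\<Sum>a<m. H $$ (i, idx (f a)) * z a))\<^sup>2)" for z
          by (rule Hbound)
        show "0 \<le> real m * real N * c" using c by simp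
      qed (rule less)
    qed (use \<gamma>m in auto)
  }
  {
    assume "submatrix_inverse_condition N A m \<epsilon> 1"
    then obtain \<gamma>m where "\<gamma>m \<subseteq> {..<N}"
      and all: "\<forall>\<gamma>. \<gamma>m \<subseteq> \<gamma> \<and> \<gamma> \<subseteq> {..<N} \<and> invertible_mat (principal_submatrix B \<gamma>) \<longrightarrow>
        m \<le> eig_count (\<epsilon> / 1) (inv_mat (principal_submatrix B \<gamma>))"
      unfolding submatrix_inverse_condition_def B_def[symmetric] by blast
    \<comment> \<open>For \<gamma> = \<open>{..<N}\<close> the submatrix is \<open>B\<close>, which
      is invertible with inverse \<open>A\<close>, so the condition speaks of \<open>A\<close>
      itself.\<close>
    moreover have "invertible_mat B" "inv_mat B = A" using inv_mat_unique[OF B A BA] by auto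
    ultimately show "m \<le> eig_count \<epsilon> A"
      using all[rule_format, of "{..<N}"] by (simp add: principal_submatrix_full[OF B])
  }
qed

end
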